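(* Consider the two-stage stochastic program $$\min_{\bm x,\bm y^s}\ \bm c^\top \bm x+\sum_{s\in\mathcal S}p^s \bm q^{s\top}\bm y^s\quad\text{s.t.}\quad \bm W\bm y^s=\bm h^s-\bm T^s\bm x,\ \ \bm y^s\ge \bm 0\ \ (s\in\mathcal S),\quad \bm x\in\mathcal X, \qquad (\mathrm{DEP})$$ and a refinement chain with $J$ levels composed either of disjoint subsets (type (D)) or of subsets with fixed scenarios appearing in all of them (type (F)). Then for each level $j=1,\dots,J$, the Benders master problem at level $j$, $$\begin{aligned}\min_{\bm x,\theta_i^{(j)}}\ & \bm c^\top \bm x+\sum_{i=1}^{m_j}\pi_i^{(j)}\theta_i^{(j)}\\ \text{s.t.}\ & (\bm h_i^{(j)}-\bm T_i^{(j)}\bm x)^\top \bm r\le 0 && \forall \bm r\in\mathcal R(\Lambda_i^{(j)}),\ i=1,\dots,m_j,\\ & (\bm h_i^{(j)}-\bm T_i^{(j)}\bm x)^\top \bm e\le \theta_i^{(j)} && \forall \bm e\in\mathcal E(\Lambda_i^{(j)}),\ i=1,\dots,m_j,\\ & \theta_i^{(j)}\in\mathbb R\ (i=1,\dots,m_j),\quad \bm x\in\mathcal X,\end{aligned}$$ solved by the iterative L-shaped procedure described in the context, converges to the optimal solution of the original two-stage stochastic program $(\mathrm{DEP})$.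
   Context: Data. $\mathcal X\subseteq\mathbb R^n$ is nonempty and closed; $\bm c\in\mathbb R^n$; $\bm W\in\mathbb R^{p\times m}$; $\mathcal S=\{1,\dots,|\mathcal S|\}$ is finite; for $s\in\mathcal S$, $\bm T^s\in\mathbb R^{p\times n}$, $\bm h^s\in\mathbb R^p$, $\bm q^s\in\mathbb R^m$. The scenarios are $\Omega=\{\bm\omega^1,\dots,\bm\omega^{|\mathcal S|}\}$ with probability measure $\mathbb P$, $p^s=\mathbb P(\bm\omega^s)>0$, $\sum_s p^s=1$. Refinement chain. For each level $j=1,\dots,J$ there is a collection $\{\Omega_i^{(j)}\}_{i=1}^{m_j}$ of nonempty subsets of $\Omega$, with $m_J=1$, $\Omega_1^{(J)}=\Omega$, such that (R1) $\Omega=\bigcup_{i}\Omega_i^{(j)}$ for each $j$; (R2) for $j\ge 2$ each $\Omega_i^{(j)}$ is a union $\bigcup_{\ell=1}^{N_i}\Omega_{k_\ell}^{(j-1)}$ of sets of level $j-1$. Each $\Omega_i^{(j)}$ carries a probability measure $\mathbb P_i^{(j)}$ (with $\mathbb P_1^{(J)}=\mathbb P$) such that (P1) $\mathbb P_i^{(j)}$ has support $\Omega_i^{(j)}$; (P2) $\mathbb P=\sum_{i=1}^{m_j}\pi_i^{(j)}\mathbb P_i^{(j)}$ with intra-level weights $\pi_i^{(j)}\ge0$, $\sum_i\pi_i^{(j)}=1$; (P3) for $j\ge2$, $\mathbb P_i^{(j)}=\sum_{\ell=1}^{N_i}\pi_{k_\ell,i}^{(j-1,j)}\mathbb P_{k_\ell}^{(j-1)}$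 with inter-level weights $\pi_{k_\ell,i}^{(j-1,j)}\ge0$, $\sum_\ell\pi_{k_\ell,i}^{(j-1,j)}=1$. Write $p^s_{\Omega_i^{(j)}}:=\mathbb P_i^{(j)}(\bm\omega^s)$. Type (D), disjoint partitions: at each level the subsets are pairwise disjoint, $p^s_{\Omega_i^{(j)}}=p^s/\sum_{k:\bm\omega^k\in\Omega_i^{(j)}}p^k$ for $\bm\omega^s\in\Omega_i^{(j)}$, and $\pi_i^{(j)}=\sum_{k:\bm\omega^k\in\Omega_i^{(j)}}p^k$. Type (F), fixed scenarios: for some $f\ge1$, all subsets at all levels contain the fixed scenarios $F=\{\bm\omega^1,\dots,\bm\omega^f\}$; at each level every non-fixed scenario belongs to exactly one subset, and each subset contains at least one non-fixed scenario; $p^s_{\Omega_i^{(j)}}=p^s$ for $s\le f$, $p^s_{\Omega_i^{(j)}}=\frac{1-\sum_{k=1}^f p^k}{\sum_{k:\bm\omega^k\in\Omega_i^{(j)}\setminus F}p^k}\,p^s$ for $\bm\omega^s\in\Omega_i^{(j)}\setminus F$, and $\pi_i^{(j)}=\frac{\sum_{k:\bm\omega^k\in\Omega_i^{(j)}\setminus F}p^k}{1-\sum_{k=1}^f p^k}$. Dual objects. $\Lambda^s=\{\bm\lambda\in\mathbb R^p:\bm W^\top\bm\lambda\le\bm q^s\}$. For a subset $\Omega_i^{(j)}$, $\Lambda_i^{(j)}=\prod_{s:\bm\omega^s\in\Omega_i^{(j)}}\{\bm\lambda^s\in\mathbb R^p:\bm W^\top\bm\lambda^s\le p^s_{\Omega_i^{(j)}}\bm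 q^s\}$; $\bm h_i^{(j)}$ and $\bm T_i^{(j)}$ are obtained by stacking $\bm h^s$ and $\bm T^s$ over $s$ with $\bm\omega^s\in\Omega_i^{(j)}$. The dual subproblem at $\bm x$ for $\Omega_i^{(j)}$ is $\max\{(\bm h_i^{(j)}-\bm T_i^{(j)}\bm x)^\top\bm\lambda:\bm\lambda\in\Lambda_i^{(j)}\}$. $\mathcal E(\cdot)$ and $\mathcal R(\cdot)$ denote the finite sets of extreme points and of (representatives, up to positive scaling, of) extreme rays. It is assumed that the $\Lambda^s$ are nonempty and that each dual subproblem either is unbounded along an extreme ray or attains its optimum at an extreme point. L-shaped procedure at level $j$. Keep only a finite subset of the feasibility cuts ($\bm r$-constraints) and optimality cuts ($\bm e$-constraints). At each iteration solve this relaxed master problem to obtain a trial solution $(\overline{\bm x},\overline{\theta})$; solve the $m_j$ dual subproblems at $\bm x=\overline{\bm x}$; whenever a subproblem is unbounded, add a violated feasibility cut given by an extreme ray; otherwise add the optimality cut given by an optimal extreme point if it is violated; repeat. As is implicit in this procedure, the relaxed master problems are assumed solvable and $(\mathrm{DEP})$ is assumed to have an optimal solution. Convergence means that after finitely many iterations no violated cut exists, and the trial first-stage vector then obtained is an optimal first-stage solution of $(\mathrm{DEP})$, with the master optimal value equal to the optimal value of $(\mathrm{DEP})$. *)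

theory Defs
  imports "HOL-Probability.Probability"
begin

section \<open>The two-stage stochastic program\<close>

text \<open>
  The finite type \<open>'s\<close> serves both as the index set of the scenarios and as the scenario set
  \<open>\<Omega>\<close>: the index \<open>s\<close> is identified with the scenario \<open>\<omega>\<^sup>s\<close>. The number \<open>p\<^sup>s\<close> is \<open>pmf (prob SP) s\<close>.
  The order \<open>\<le>\<close> on vectors is the componentwise one.
\<close>

record ('n::finite, 'm::finite, 'p::finite, 's::finite) two_stage =
  xset :: "(real^'n) set"
  cost :: "real^'n"
  recourse :: "real^'m^'p"
  prob :: "'s pmf"
  tech :: "'s \<Rightarrow> real^'n^'p"
  rhs :: "'s \<Rightarrow> real^'p"
  scost :: "'s \<Rightarrow> real^'m"

definition two_stage_program :: "('n::finite, 'm::finite, 'p::finite, 's::finite) two_stage \<Rightarrow> bool" where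
  "two_stage_program SP \<longleftrightarrow> xset SP \<noteq> {} \<and> closed (xset SP) \<and> (\<forall>s. pmf (prob SP) s > 0)"

definition dep_feasible ::
  "('n::finite, 'm::finite, 'p::finite, 's::finite) two_stage \<Rightarrow> real^'n \<Rightarrow> ('s \<Rightarrow> real^'m) \<Rightarrow> bool" where
  "dep_feasible SP x y \<longleftrightarrow> x \<in> xset SP \<and>
     (\<forall>s. recourse SP *v y s = rhs SP s - tech SP s *v x \<and> 0 \<le> y s)"

definition dep_objective ::
  "('n::finite, 'm::finite, 'p::finite, 's::finite) two_stage \<Rightarrow> real^'n \<Rightarrow> ('s \<Rightarrow> real^'m) \<Rightarrow> real" where
  "dep_objective SP x y = cost SP \<bullet> x + (\<Sum>s\<in>UNIV. pmf (prob SP) s * (scost SP s \<bullet> y s))"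

definition dep_optimal ::
  "('n::finite, 'm::finite, 'p::finite, 's::finite) two_stage \<Rightarrow> real^'n \<Rightarrow> ('s \<Rightarrow> real^'m) \<Rightarrow> bool" where
  "dep_optimal SP x y \<longleftrightarrow> dep_feasible SP x y \<and>
     (\<forall>x' y'. dep_feasible SP x' y' \<longrightarrow> dep_objective SP x y \<le> dep_objective SP x' y')"


section \<open>Refinement chains\<close>

text \<open>
  Levels are \<open>1, \<dots>, levels RC\<close> and the subsets of level \<open>j\<close> are \<open>scens RC j i\<close> for
  \<open>i = 1, \<dots>, nsub RC j\<close>; values outside these index ranges are irrelevant. The set
  \<open>parts RC j i\<close> collects the indices \<open>k\<^sub>\<ell>\<close> of the sets of level \<open>j - 1\<close> that make up
  \<open>scens RC j i\<close>, and \<open>inter_weight RC j k i\<close> is the weight of the \<open>k\<close>-th measure of level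
  \<open>j - 1\<close> in the \<open>i\<close>-th measure of level \<open>j\<close>.
\<close>

record ('s::finite) subset_chain =
  levels :: nat
  nsub :: "nat \<Rightarrow> nat"
  scens :: "nat \<Rightarrow> nat \<Rightarrow> 's set"
  law :: "nat \<Rightarrow> nat \<Rightarrow> 's pmf"
  weight :: "nat \<Rightarrow> nat \<Rightarrow> real"
  parts :: "nat \<Rightarrow> nat \<Rightarrow> nat set"
  inter_weight :: "nat \<Rightarrow> nat \<Rightarrow> nat \<Rightarrow> real"

definition refinement_chain :: "'s::finite pmf \<Rightarrow> 's subset_chain \<Rightarrow> bool" where
  "refinement_chain P RC \<longleftrightarrow>
     levels RC \<ge> 1 \<and> nsub RC (levels RC) = 1 \<and>
     scens RC (levels RC) 1 = UNIV \<and> law RC (levels RC) 1 = P \<and>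
     (\<forall>j\<in>{1..levels RC}.
        (\<forall>i\<in>{1..nsub RC j}. scens RC j i \<noteq> {}) \<and>
        (\<Union>i\<in>{1..nsub RC j}. scens RC j i) = UNIV \<and>
        (\<forall>i\<in>{1..nsub RC j}. set_pmf (law RC j i) = scens RC j i) \<and>
        (\<forall>i\<in>{1..nsub RC j}. weight RC j i \<ge> 0) \<and>
        (\<Sum>i=1..nsub RC j. weight RC j i) = 1 \<and>
        (\<forall>s. pmf P s = (\<Sum>i=1..nsub RC j. weight RC j i * pmf (law RC j i) s))) \<and>
     (\<forall>j\<in>{2..levels RC}. \<forall>i\<in>{1..nsub RC j}.
        parts RC j i \<subseteq> {1..nsub RC (j - 1)} \<and>
        scens RC j i = (\<Union>k\<in>parts RC j i. scens RC (j - 1) k) \<and>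
        (\<forall>k\<in>parts RC j i. inter_weight RC j k i \<ge> 0) \<and>
        (\<Sum>k\<in>parts RC j i. inter_weight RC j k i) = 1 \<and>
        (\<forall>s. pmf (law RC j i) s =
               (\<Sum>k\<in>parts RC j i. inter_weight RC j k i * pmf (law RC (j - 1) k) s)))"

definition disjoint_type :: "'s::finite pmf \<Rightarrow> 's subset_chain \<Rightarrow> bool" where
  "disjoint_type P RC \<longleftrightarrow>
     (\<forall>j\<in>{1..levels RC}.
        (\<forall>i\<in>{1..nsub RC j}. \<forall>i'\<in>{1..nsub RC j}.
           i \<noteq> i' \<longrightarrow> scens RC j i \<inter> scens RC j i' = {}) \<and>
        (\<forall>i\<in>{1..nsub RC j}.
           (\<forall>s\<in>scens RC j i. pmf (law RC j i) s = pmf P s / (\<Sum>k\<in>scens RC j i. pmf P k)) \<and>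
           weight RC j i = (\<Sum>k\<in>scens RC j i. pmf P k)))"

text \<open>
  \<open>F\<close> is the set of fixed scenarios. As scenarios are not ordered here, \<open>F\<close> is an arbitrary
  nonempty set of scenarios instead of the first \<open>f \<ge> 1\<close> ones.
\<close>

definition fixed_type :: "'s::finite pmf \<Rightarrow> 's set \<Rightarrow> 's subset_chain \<Rightarrow> bool" where
  "fixed_type P F RC \<longleftrightarrow> F \<noteq> {} \<and>
     (\<forall>j\<in>{1..levels RC}.
        (\<forall>s. s \<notin> F \<longrightarrow> (\<exists>!i. i \<in> {1..nsub RC j} \<and> s \<in> scens RC j i)) \<and>
        (\<forall>i\<in>{1..nsub RC j}.
           F \<subseteq> scens RC j i \<and> scens RC j i - F \<noteq> {} \<and>
           (\<forall>s\<in>F. pmf (law RC j i) s = pmf P s) \<and>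
           (\<forall>s\<in>scens RC j i - F. pmf (law RC j i) s =
              (1 - (\<Sum>k\<in>F. pmf P k)) / (\<Sum>k\<in>scens RC j i - F. pmf P k) * pmf P s) \<and>
           weight RC j i = (\<Sum>k\<in>scens RC j i - F. pmf P k) / (1 - (\<Sum>k\<in>F. pmf P k))))"


section \<open>Extreme rays\<close>

definition recession_cone :: "'a::real_vector set \<Rightarrow> 'a set" where
  "recession_cone C = {d. \<forall>x\<in>C. \<forall>t\<ge>0. x + t *\<^sub>R d \<in> C}"

definition extreme_ray_of :: "'a::real_vector \<Rightarrow> 'a set \<Rightarrow> bool" (infixr "extreme'_ray'_of" 50) where
  "r extreme_ray_of C \<longleftrightarrow> r \<noteq> 0 \<and> {t *\<^sub>R r | t. t \<ge> 0} face_of recession_cone C"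

definition ray_representatives :: "'a::real_vector set \<Rightarrow> 'a set \<Rightarrow> bool" where
  "ray_representatives C R \<longleftrightarrow> (\<forall>r\<in>R. r extreme_ray_of C) \<and>
     (\<forall>d. d extreme_ray_of C \<longrightarrow> (\<exists>!r. r \<in> R \<and> (\<exists>t>0. d = t *\<^sub>R r)))"


section \<open>Dual subproblems\<close>

text \<open>
  A vector of stacked blocks \<open>v\<^sup>s\<close>, with \<open>s\<close> ranging over a set \<open>A\<close> of scenarios, is represented
  in \<open>real^'p^'s\<close> by putting zero blocks outside \<open>A\<close>. This embeds the space of the stacked
  vectors as a coordinate subspace and preserves inner products, extreme points and extreme rays.
\<close>

definition stack :: "'s::finite set \<Rightarrow> ('s \<Rightarrow> real^'p::finite) \<Rightarrow> real^'p^'s" where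
  "stack A v = (\<chi> s. if s \<in> A then v s else 0)"

definition scenario_dual_set ::
  "('n::finite, 'm::finite, 'p::finite, 's::finite) two_stage \<Rightarrow> 's \<Rightarrow> (real^'p) set" where
  "scenario_dual_set SP s = {l. transpose (recourse SP) *v l \<le> scost SP s}"

definition dual_set ::
  "('n::finite, 'm::finite, 'p::finite, 's::finite) two_stage \<Rightarrow> 's subset_chain \<Rightarrow> nat \<Rightarrow> nat
    \<Rightarrow> (real^'p^'s) set" where
  "dual_set SP RC j i = {stack (scens RC j i) l | l.
     \<forall>s\<in>scens RC j i. transpose (recourse SP) *v l s \<le> pmf (law RC j i) s *\<^sub>R scost SP s}"

text \<open>The vector \<open>h\<^sub>i - T\<^sub>i x\<close>, where \<open>h\<^sub>i\<close> and \<open>T\<^sub>i\<close> are stacked over \<open>scens RC j i\<close>.\<close>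

definition dual_coeff ::
  "('n::finite, 'm::finite, 'p::finite, 's::finite) two_stage \<Rightarrow> 's subset_chain \<Rightarrow> nat \<Rightarrow> nat
    \<Rightarrow> real^'n \<Rightarrow> real^'p^'s" where
  "dual_coeff SP RC j i x =
     stack (scens RC j i) (rhs SP) - stack (scens RC j i) (\<lambda>s. tech SP s *v x)"

definition dual_extreme_points ::
  "('n::finite, 'm::finite, 'p::finite, 's::finite) two_stage \<Rightarrow> 's subset_chain \<Rightarrow> nat \<Rightarrow> nat
    \<Rightarrow> (real^'p^'s) set" where
  "dual_extreme_points SP RC j i = {e. e extreme_point_of dual_set SP RC j i}"

definition dual_unbounded ::
  "('n::finite, 'm::finite, 'p::finite, 's::finite) two_stage \<Rightarrow> 's subset_chain \<Rightarrow> nat \<Rightarrow> nat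
    \<Rightarrow> real^'n \<Rightarrow> bool" where
  "dual_unbounded SP RC j i x \<longleftrightarrow>
     \<not> bdd_above ((\<lambda>l. dual_coeff SP RC j i x \<bullet> l) ` dual_set SP RC j i)"

definition dual_optimal ::
  "('n::finite, 'm::finite, 'p::finite, 's::finite) two_stage \<Rightarrow> 's subset_chain \<Rightarrow> nat \<Rightarrow> nat
    \<Rightarrow> real^'n \<Rightarrow> real^'p^'s \<Rightarrow> bool" where
  "dual_optimal SP RC j i x e \<longleftrightarrow> e \<in> dual_set SP RC j i \<and>
     (\<forall>l\<in>dual_set SP RC j i. dual_coeff SP RC j i x \<bullet> l \<le> dual_coeff SP RC j i x \<bullet> e)"

text \<open>
  The objective is unbounded along a direction \<open>r\<close> of recession iff it strictly increases along \<open>r\<close>.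
\<close>

definition dual_dichotomy ::
  "('n::finite, 'm::finite, 'p::finite, 's::finite) two_stage \<Rightarrow> 's subset_chain \<Rightarrow> nat \<Rightarrow> nat
    \<Rightarrow> real^'n \<Rightarrow> bool" where
  "dual_dichotomy SP RC j i x \<longleftrightarrow>
     (\<exists>r. r extreme_ray_of dual_set SP RC j i \<and> dual_coeff SP RC j i x \<bullet> r > 0) \<or>
     (\<exists>e\<in>dual_extreme_points SP RC j i. dual_optimal SP RC j i x e)"


section \<open>Master problems and the L-shaped procedure\<close>

text \<open>
  A collection of cuts is a pair of families, indexed by the subsets of the level: the
  vectors defining the feasibility cuts and those defining the optimality cuts. The variables
  \<open>\<theta>\<^sub>i\<close> form a function on the indices; only \<open>i = 1, \<dots>, nsub RC j\<close> matter.
\<close>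

type_synonym ('p, 's) cuts = "(nat \<Rightarrow> (real^'p^'s) set) \<times> (nat \<Rightarrow> (real^'p^'s) set)"

definition master_feasible ::
  "('n::finite, 'm::finite, 'p::finite, 's::finite) two_stage \<Rightarrow> 's subset_chain \<Rightarrow> nat
    \<Rightarrow> ('p, 's) cuts \<Rightarrow> real^'n \<Rightarrow> (nat \<Rightarrow> real) \<Rightarrow> bool" where
  "master_feasible SP RC j C x \<theta> \<longleftrightarrow> x \<in> xset SP \<and>
     (\<forall>i\<in>{1..nsub RC j}.
        (\<forall>r\<in>fst C i. dual_coeff SP RC j i x \<bullet> r \<le> 0) \<and>
        (\<forall>e\<in>snd C i. dual_coeff SP RC j i x \<bullet> e \<le> \<theta> i))"

definition master_objective ::
  "('n::finite, 'm::finite, 'p::finite, 's::finite) two_stage \<Rightarrow> 's subset_chain \<Rightarrow> nat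
    \<Rightarrow> real^'n \<Rightarrow> (nat \<Rightarrow> real) \<Rightarrow> real" where
  "master_objective SP RC j x \<theta> = cost SP \<bullet> x + (\<Sum>i=1..nsub RC j. weight RC j i * \<theta> i)"

definition master_optimal ::
  "('n::finite, 'm::finite, 'p::finite, 's::finite) two_stage \<Rightarrow> 's subset_chain \<Rightarrow> nat
    \<Rightarrow> ('p, 's) cuts \<Rightarrow> real^'n \<Rightarrow> (nat \<Rightarrow> real) \<Rightarrow> bool" where
  "master_optimal SP RC j C x \<theta> \<longleftrightarrow> master_feasible SP RC j C x \<theta> \<and>
     (\<forall>x' \<theta>'. master_feasible SP RC j C x' \<theta>' \<longrightarrow>
        master_objective SP RC j x \<theta> \<le> master_objective SP RC j x' \<theta>')"

text \<open>
  The cuts of the Benders master problem itself, where \<open>R i\<close> is the chosen set of representatives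
  of the extreme rays of \<open>dual_set SP RC j i\<close>.
\<close>

definition all_cuts ::
  "('n::finite, 'm::finite, 'p::finite, 's::finite) two_stage \<Rightarrow> 's subset_chain \<Rightarrow> nat
    \<Rightarrow> (nat \<Rightarrow> (real^'p^'s) set) \<Rightarrow> ('p, 's) cuts" where
  "all_cuts SP RC j R = (R, dual_extreme_points SP RC j)"

definition initial_cuts ::
  "('n::finite, 'm::finite, 'p::finite, 's::finite) two_stage \<Rightarrow> 's subset_chain \<Rightarrow> nat
    \<Rightarrow> (nat \<Rightarrow> (real^'p^'s) set) \<Rightarrow> ('p, 's) cuts \<Rightarrow> bool" where
  "initial_cuts SP RC j R C \<longleftrightarrow>
     (\<forall>i\<in>{1..nsub RC j}. finite (fst C i) \<and> fst C i \<subseteq> fst (all_cuts SP RC j R) i \<and>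
        finite (snd C i) \<and> snd C i \<subseteq> snd (all_cuts SP RC j R) i)"

definition violated_cut_exists ::
  "('n::finite, 'm::finite, 'p::finite, 's::finite) two_stage \<Rightarrow> 's subset_chain \<Rightarrow> nat
    \<Rightarrow> (nat \<Rightarrow> (real^'p^'s) set) \<Rightarrow> real^'n \<Rightarrow> (nat \<Rightarrow> real) \<Rightarrow> bool" where
  "violated_cut_exists SP RC j R x \<theta> \<longleftrightarrow>
     (\<exists>i\<in>{1..nsub RC j}.
        (\<exists>r\<in>fst (all_cuts SP RC j R) i. dual_coeff SP RC j i x \<bullet> r > 0) \<or>
        (\<exists>e\<in>snd (all_cuts SP RC j R) i. dual_coeff SP RC j i x \<bullet> e > \<theta> i))"

text \<open>
  \<open>add_cuts SP RC j R x \<theta> C C'\<close>: solving the subproblems of level \<open>j\<close> at the trial solution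
  \<open>(x, \<theta>)\<close> may turn the cuts \<open>C\<close> into \<open>C'\<close>. Neither the violated ray nor the optimal
  extreme point need be unique, hence a relation.
\<close>

definition add_cuts ::
  "('n::finite, 'm::finite, 'p::finite, 's::finite) two_stage \<Rightarrow> 's subset_chain \<Rightarrow> nat
    \<Rightarrow> (nat \<Rightarrow> (real^'p^'s) set) \<Rightarrow> real^'n \<Rightarrow> (nat \<Rightarrow> real)
    \<Rightarrow> ('p, 's) cuts \<Rightarrow> ('p, 's) cuts \<Rightarrow> bool" where
  "add_cuts SP RC j R x \<theta> C C' \<longleftrightarrow>
     (\<forall>i\<in>{1..nsub RC j}.
        if dual_unbounded SP RC j i x
        then \<exists>r\<in>R i. dual_coeff SP RC j i x \<bullet> r > 0 \<and>
               fst C' i = insert r (fst C i) \<and> snd C' i = snd C i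
        else \<exists>e\<in>dual_extreme_points SP RC j i. dual_optimal SP RC j i x e \<and>
               fst C' i = fst C i \<and>
               snd C' i = (if dual_coeff SP RC j i x \<bullet> e > \<theta> i then insert e (snd C i) else snd C i))"

text \<open>One iteration that does not stop, i.e. whose trial solution violates some cut.\<close>

definition lshaped_step ::
  "('n::finite, 'm::finite, 'p::finite, 's::finite) two_stage \<Rightarrow> 's subset_chain \<Rightarrow> nat
    \<Rightarrow> (nat \<Rightarrow> (real^'p^'s) set) \<Rightarrow> ('p, 's) cuts \<Rightarrow> ('p, 's) cuts \<Rightarrow> bool" where
  "lshaped_step SP RC j R C C' \<longleftrightarrow>
     (\<exists>x \<theta>. master_optimal SP RC j C x \<theta> \<and> violated_cut_exists SP RC j R x \<theta> \<and>
        add_cuts SP RC j R x \<theta> C C')"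

end

theory Submission imports Defs begin

text \<open>
  A stacked dual set is a product of scaled copies of the scenario dual sets, so by linear
  programming duality the optimal value of the subproblem for a subset is the sum of the recourse
  costs of its scenarios, weighted by the law of the subset. Averaging these values with the
  weights of the level gives back the expected recourse cost, because the laws of the level
  average to the law of the scenarios. The procedure stops because dual sets are polyhedra: they
  have finitely many extreme points and extreme rays, and a non-final iteration adds a cut that
  is violated by the trial solution, hence a new one.
\<close>

section \<open>Linear programming duality\<close>

lemma inner_vec_mono:
  fixes u v y :: "real^'m::finite"
  assumes "u \<le> v" "0 \<le> y"
  shows "u \<bullet> y \<le> v \<bullet> y"
  using assms unfolding inner_vec_def less_eq_vec_def
  by (intro sum_mono) (simp add: mult_right_mono)

text \<open>Moving \<open>W\<close> across the inner product gives
  \<open>b \<bullet> l = (transpose W *v l) \<bullet> y\<close>, and \<open>0 \<le> y\<close>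
  preserves the dual inequality.\<close>

lemma lp_weak_duality:
  fixes W :: "real^'m::finite^'p::finite"
  assumes "transpose W *v l \<le> q" "W *v y = b" "0 \<le> y"
  shows "b \<bullet> l \<le> q \<bullet> y"
proof -
  have "b \<bullet> l = (transpose W *v l) \<bullet> y"
    using assms(2) by (metis dot_lmul_matrix inner_commute transpose_matrix_vector)
  also have "\<dots> \<le> q \<bullet> y"
    using assms by (intro inner_vec_mono)
  finally show ?thesis .
qed

text \<open>A Farkas argument: if \<open>(b, v)\<close> were outside the cone of all pairs of
  right-hand side and attainable cost bound, a separating functional would produce a dual feasible
  point with value above \<open>v\<close>. Stating it for any upper bound \<open>v\<close> avoids
  assuming that either optimum is attained.\<close>

lemma lp_strong_duality:
  fixes W :: "real^'m::finite^'p::finite"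
  assumes l0: "transpose W *v l0 \<le> q"
    and bound: "\<And>l. transpose W *v l \<le> q \<Longrightarrow> b \<bullet> l \<le> v"
  obtains y where "0 \<le> y" "W *v y = b" "q \<bullet> y \<le> v"
proof -
  \<comment> \<open>The generators are the columns of \<open>W\<close> paired with their costs, and
    a slack direction \<open>(0, 1)\<close> that lets the last entry exceed the cost. Being finite,
    \<open>G\<close> has a closed conic hull; \<open>K\<close> describes its elements
    explicitly.\<close>
  define G where "G = insert (0, 1) (range (\<lambda>k. (W *v axis k 1, q $ k)))"
  define K where "K = {(W *v y, q \<bullet> y + s) | y s. 0 \<le> y \<and> (0::real) \<le> s}"
  have "convex_cone K"
    unfolding convex_cone_iff
  proof (intro conjI ballI allI impI)
    have "(W *v 0, q \<bullet> 0 + 0) \<in> K" unfolding K_def by blast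
    then show "0 \<in> K" by (simp add: zero_prod_def)
  next
    fix x x' assume "x \<in> K" "x' \<in> K"
    then obtain y s y' s' where
      "x = (W *v y, q \<bullet> y + s)" "0 \<le> y" "0 \<le> s"
      "x' = (W *v y', q \<bullet> y' + s')" "0 \<le> y'" "0 \<le> s'"
      unfolding K_def by blast
    then have "x + x' = (W *v (y + y'), q \<bullet> (y + y') + (s + s')) \<and> 0 \<le> y + y' \<and> 0 \<le> s + s'"
      by (simp add: matrix_vector_right_distrib inner_add_right less_eq_vec_def)
    then show "x + x' \<in> K" unfolding K_def by blast
  next
    fix x and c :: real assume "x \<in> K" "0 \<le> c"
    then obtain y s where "x = (W *v y, q \<bullet> y + s)" "0 \<le> y" "0 \<le> s"
      unfolding K_def by blast
    then have "c *\<^sub>R x = (W *v (c *\<^sub>R y), q \<bullet> (c *\<^sub>R y) + c * s) \<and> 0 \<le> c *\<^sub>R y \<and> 0 \<le> c * s"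
      using \<open>0 \<le> c\<close> by (simp add: matrix_vector_mult_scaleR less_eq_vec_def algebra_simps)
    then show "c *\<^sub>R x \<in> K" unfolding K_def by blast
  qed
  moreover have "G \<subseteq> K"
  proof -
    have "(0, 1) = (W *v 0, q \<bullet> 0 + 1)" by simp
    then have "(0, 1) \<in> K" unfolding K_def by (blast intro: zero_le_one)
    moreover have "(W *v axis k 1, q $ k) \<in> K" for k
    proof -
      have "(W *v axis k 1, q $ k) = (W *v axis k 1, q \<bullet> axis k 1 + 0)"
        by (simp add: inner_axis)
      moreover have "0 \<le> (axis k 1 :: real^'m)" by (simp add: less_eq_vec_def axis_def)
      ultimately show ?thesis unfolding K_def by blast
    qed
    ultimately show ?thesis unfolding G_def by blast
  qed
  ultimately have hull_sub: "convex_cone hull G \<subseteq> K"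
    by (simp add: hull_minimal)
  have "(b, v) \<in> convex_cone hull G"
  proof (rule ccontr)
    assume "(b, v) \<notin> convex_cone hull G"
    moreover have "closed (convex_cone hull G)"
      unfolding G_def by (intro closed_convex_cone_hull) simp
    ultimately obtain a t \<beta> where sep: "(a, t) \<bullet> (b, v) < \<beta>"
      and above: "\<And>x. x \<in> convex_cone hull G \<Longrightarrow> \<beta> < (a, t) \<bullet> x"
      using separating_hyperplane_closed_point[OF convex_convex_cone_hull, of G "(b, v)"]
      by (metis surj_pair)
    have "\<beta> < 0"
      using above[OF convex_cone_hull_contains_0] by simp
    have nonneg: "0 \<le> (a, t) \<bullet> x" if "x \<in> G" for x
    proof (rule ccontr)
      assume neg: "\<not> 0 \<le> (a, t) \<bullet> x"
      \<comment> \<open>Scaling by \<open>c\<close> moves \<open>x\<close> to a point of the cone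
        where the functional equals \<open>\<beta>\<close>, although it lies strictly above
        \<open>\<beta>\<close> on the whole cone.\<close>
      define c where "c = \<beta> / ((a, t) \<bullet> x)"
      have "0 \<le> c" using neg \<open>\<beta> < 0\<close> by (simp add: c_def divide_nonpos_neg)
      then have "c *\<^sub>R x \<in> convex_cone hull G"
        using that by (simp add: conic_convex_cone_hull conic_mul hull_inc)
      from above[OF this] neg show False by (simp add: c_def)
    qed
    have "0 \<le> t" using nonneg[of "(0, 1)"] by (simp add: G_def)
    have "0 \<le> (transpose W *v a + t *\<^sub>R q) $ k" for k
    proof -
      have "0 \<le> a \<bullet> (W *v axis k 1) + t * q $ k"
        using nonneg[of "(W *v axis k 1, q $ k)"] by (simp add: G_def)
      also have "a \<bullet> (W *v axis k 1) = (transpose W *v a) $ k"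
        by (metis dot_lmul_matrix inner_axis inner_real_def mult.right_neutral transpose_matrix_vector)
      finally show ?thesis by simp
    qed
    then have "- (transpose W *v a) $ k \<le> (t *\<^sub>R q) $ k" for k
      unfolding vector_add_component by (smt (verit))
    \<comment> \<open>Nonnegativity on the generators says that \<open>- a\<close> is dual feasible
      for the cost \<open>t *\<^sub>R q\<close> with \<open>0 \<le> t\<close>.\<close>
    then have a: "transpose W *v (- a) \<le> t *\<^sub>R q"
      unfolding less_eq_vec_def linear_neg[OF matrix_vector_mul_linear] by simp
    have ab: "a \<bullet> b + t * v < 0" using sep \<open>\<beta> < 0\<close> by simp
    show False
    proof (cases "t = 0")
      case True
      \<comment> \<open>For \<open>t = 0\<close> the vector \<open>- a\<close> is a dual recession
        direction that improves the objective. The factor \<open>c\<close> is large enough to lift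
        the value at \<open>l0\<close> above \<open>v\<close>.\<close>
      define c where "c = (\<bar>v - b \<bullet> l0\<bar> + 1) / - (a \<bullet> b)"
      have pos: "0 < - (a \<bullet> b)" using ab True by simp
      then have "0 \<le> c" unfolding c_def by (intro divide_nonneg_pos) auto
      have "transpose W *v (l0 + c *\<^sub>R (- a)) = transpose W *v l0 + c *\<^sub>R (transpose W *v (- a))"
        by (simp only: matrix_vector_right_distrib matrix_vector_mult_scaleR)
      also have "\<dots> \<le> q"
      proof -
        have "c * (transpose W *v (- a)) $ k \<le> 0" for k
          using a True \<open>0 \<le> c\<close> by (intro mult_nonneg_nonpos) (auto simp: less_eq_vec_def)
        then show ?thesis using l0 unfolding less_eq_vec_def
          by (metis add.right_neutral add_mono real_scaleR_def vector_add_component vector_scaleR_component)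
      qed
      finally have "b \<bullet> (l0 + c *\<^sub>R (- a)) \<le> v" by (rule bound)
      moreover have "b \<bullet> (l0 + c *\<^sub>R (- a)) = b \<bullet> l0 + (\<bar>v - b \<bullet> l0\<bar> + 1)"
        using pos unfolding c_def inner_add_right inner_scaleR_right inner_minus_right
        by (simp add: inner_commute[of b a])
      ultimately show False by linarith
    next
      case False
      \<comment> \<open>For \<open>0 < t\<close>, rescaling \<open>- a\<close> by
        \<open>1 / t\<close> gives a dual feasible point whose value exceeds
        \<open>v\<close>.\<close>
      then have "0 < t" using \<open>0 \<le> t\<close> by simp
      have "transpose W *v ((1 / t) *\<^sub>R (- a)) = (1 / t) *\<^sub>R (transpose W *v (- a))"
        by (simp only: matrix_vector_mult_scaleR)
      also have "\<dots> \<le> q"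
        using a \<open>0 < t\<close> unfolding less_eq_vec_def
        by (simp add: pos_divide_le_eq mult.commute del: transpose_matrix_vector)
      finally have "b \<bullet> ((1 / t) *\<^sub>R (- a)) \<le> v" by (rule bound)
      then show False using ab \<open>0 < t\<close> by (simp add: inner_commute field_simps)
    qed
  qed
  with hull_sub obtain y s where "(b, v) = (W *v y, q \<bullet> y + s)" "0 \<le> y" "0 \<le> s"
    unfolding K_def by blast
  then show thesis by (intro that[of y]) auto
qed

section \<open>Recession cones and extreme rays\<close>

text \<open>The adjoint writes the functional as the inner product with \<open>adjoint f 1\<close>,
  so the set is a halfspace, possibly a degenerate one.\<close>

lemma polyhedron_linear_le:
  fixes f :: "'a::euclidean_space \<Rightarrow> real"
  assumes "linear f"
  shows "polyhedron {z. f z \<le> c}"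
proof -
  have "{z. f z \<le> c} = {z. adjoint f 1 \<bullet> z \<le> c}"
    using adjoint_works[OF assms, of _ 1] by (simp add: inner_commute)
  then show ?thesis by (simp add: polyhedron_halfspace_le)
qed

text \<open>Each defining halfspace \<open>a \<bullet> x \<le> b\<close> of a nonempty polyhedron
  contributes the homogeneous halfspace \<open>a \<bullet> d \<le> 0\<close>. For the empty set,
  every direction is vacuously one of recession.\<close>

lemma polyhedron_recession_cone:
  fixes C :: "'a::euclidean_space set"
  assumes "polyhedron C"
  shows "polyhedron (recession_cone C)"
proof (cases "C = {}")
  case True
  then have "recession_cone C = UNIV" by (simp add: recession_cone_def)
  then show ?thesis by simp
next
  case False
  then obtain x0 where x0: "x0 \<in> C" by blast
  from assms obtain F where F: "finite F" "C = \<Inter> F"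
    and "\<forall>h\<in>F. \<exists>a b. a \<noteq> 0 \<and> h = {x. a \<bullet> x \<le> b}"
    unfolding polyhedron_def by auto
  then obtain a b where half: "\<And>h. h \<in> F \<Longrightarrow> h = {x. a h \<bullet> x \<le> b h}"
    by metis
  have "recession_cone C = \<Inter> ((\<lambda>h. {d. a h \<bullet> d \<le> 0}) ` F)"
  proof (intro set_eqI iffI)
    fix d assume d: "d \<in> recession_cone C"
    have "a h \<bullet> d \<le> 0" if "h \<in> F" for h
    proof (rule ccontr)
      assume neg: "\<not> a h \<bullet> d \<le> 0"
      \<comment> \<open>Going this far from \<open>x0\<close> along \<open>d\<close> raises
        \<open>a h \<bullet> x0\<close> by more than the remaining slack, so the halfspace
        \<open>h\<close> is left.\<close>
      define t where "t = (\<bar>b h - a h \<bullet> x0\<bar> + 1) / (a h \<bullet> d)"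
      have "0 \<le> t" using neg by (simp add: t_def)
      with d x0 have "x0 + t *\<^sub>R d \<in> C" by (simp add: recession_cone_def)
      then have "x0 + t *\<^sub>R d \<in> h" using F(2) that by blast
      then have "a h \<bullet> (x0 + t *\<^sub>R d) \<le> b h" using half[OF that] by blast
      moreover have "a h \<bullet> (x0 + t *\<^sub>R d) = a h \<bullet> x0 + (\<bar>b h - a h \<bullet> x0\<bar> + 1)"
        using neg by (simp add: t_def inner_add_right)
      ultimately show False by linarith
    qed
    then show "d \<in> \<Inter> ((\<lambda>h. {d. a h \<bullet> d \<le> 0}) ` F)" by blast
  next
    fix d assume d: "d \<in> \<Inter> ((\<lambda>h. {d. a h \<bullet> d \<le> 0}) ` F)"
    have "x + t *\<^sub>R d \<in> h" if "x \<in> C" "0 \<le> t" "h \<in> F" for x t h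
    proof -
      have "x \<in> h" using that F(2) by blast
      then have "a h \<bullet> x \<le> b h" using half[OF that(3)] by blast
      moreover have "t * (a h \<bullet> d) \<le> 0"
        using d that by (intro mult_nonneg_nonpos) auto
      ultimately have "a h \<bullet> (x + t *\<^sub>R d) \<le> b h" by (simp add: inner_add_right)
      then show ?thesis using half[OF that(3)] by blast
    qed
    then show "d \<in> recession_cone C" unfolding recession_cone_def F(2) by blast
  qed
  then show ?thesis using F(1) by (auto intro: polyhedron_halfspace_le)
qed

lemma extreme_ray_in_recession_cone:
  assumes "r extreme_ray_of C"
  shows "r \<in> recession_cone C"
proof -
  have "1 *\<^sub>R r \<in> {t *\<^sub>R r | t. t \<ge> 0}" by (blast intro: zero_le_one)
  moreover have "{t *\<^sub>R r | t. t \<ge> 0} \<subseteq> recession_cone C"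
    using assms face_of_imp_subset unfolding extreme_ray_of_def by blast
  ultimately have "1 *\<^sub>R r \<in> recession_cone C" by (rule rev_subsetD)
  then show ?thesis by simp
qed

text \<open>Sending a representative to the ray it spans is injective on \<open>R\<close>, and the
  images are faces of a polyhedral cone, of which there are finitely many.\<close>

lemma finite_ray_representatives:
  fixes C :: "'a::euclidean_space set"
  assumes "polyhedron C" "ray_representatives C R"
  shows "finite R"
proof (rule finite_imageD)
  let ?ray = "\<lambda>r. {t *\<^sub>R r | t. (t::real) \<ge> 0}"
  have ext: "r extreme_ray_of C" if "r \<in> R" for r
    using assms(2) that by (simp add: ray_representatives_def)
  then have "?ray ` R \<subseteq> {T. T face_of recession_cone C}"
    by (auto simp: extreme_ray_of_def)
  then show "finite (?ray ` R)"
    by (rule finite_subset) (intro finite_polyhedron_faces polyhedron_recession_cone assms(1))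
  show "inj_on ?ray R"
  proof (rule inj_onI)
    fix r r' assume r: "r \<in> R" "r' \<in> R" "?ray r = ?ray r'"
    have "1 *\<^sub>R r' \<in> ?ray r'" by (blast intro: zero_le_one)
    with r(3) obtain t where t: "0 \<le> t" "r' = t *\<^sub>R r" by auto
    moreover have "r' \<noteq> 0" using ext[OF r(2)] by (simp add: extreme_ray_of_def)
    \<comment> \<open>The factor is not 0 because \<open>r'\<close> is nonzero. Hence both
      \<open>r\<close> and \<open>r'\<close> represent the extreme ray of \<open>r'\<close>, and
      uniqueness identifies them.\<close>
    ultimately have "\<exists>t>0. r' = t *\<^sub>R r" by (metis order_le_less scaleR_zero_left)
    moreover have "\<exists>t>0. r' = t *\<^sub>R r'" by (metis scaleR_one zero_less_one)
    moreover have "\<exists>!r. r \<in> R \<and> (\<exists>t>0. r' = t *\<^sub>R r)"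
      using assms(2) ext[OF r(2)] by (simp add: ray_representatives_def)
    ultimately show "r = r'" using r(1,2) by blast
  qed
qed

text \<open>Otherwise a long enough step from \<open>z\<close> along \<open>r\<close> would exceed
  the bound \<open>v\<close>.\<close>

lemma inner_recession_cone_nonpos:
  assumes "r \<in> recession_cone C" "z \<in> C" "\<And>x. x \<in> C \<Longrightarrow> a \<bullet> x \<le> v"
  shows "a \<bullet> r \<le> 0"
proof (rule ccontr)
  assume neg: "\<not> a \<bullet> r \<le> 0"
  define t where "t = (\<bar>v - a \<bullet> z\<bar> + 1) / (a \<bullet> r)"
  have "0 \<le> t" using neg by (simp add: t_def)
  with assms(1,2) have "z + t *\<^sub>R r \<in> C" by (simp add: recession_cone_def)
  then have "a \<bullet> (z + t *\<^sub>R r) \<le> v" by (rule assms(3))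
  moreover have "a \<bullet> (z + t *\<^sub>R r) = a \<bullet> z + (\<bar>v - a \<bullet> z\<bar> + 1)"
    using neg by (simp add: t_def inner_add_right)
  ultimately show False by linarith
qed

section \<open>Dual subproblems\<close>

text \<open>A blockwise membership test that replaces the existential over stacked families; the
  zero blocks come from the padding in \<open>stack\<close>.\<close>

lemma mem_dual_set:
  "z \<in> dual_set SP RC j i \<longleftrightarrow>
     (\<forall>s. s \<notin> scens RC j i \<longrightarrow> z $ s = 0) \<and>
     (\<forall>s\<in>scens RC j i. transpose (recourse SP) *v (z $ s) \<le> pmf (law RC j i) s *\<^sub>R scost SP s)"
  (is "_ \<longleftrightarrow> ?rhs")
proof
  assume "z \<in> dual_set SP RC j i"
  then show ?rhs
    by (auto simp: dual_set_def stack_def simp del: transpose_matrix_vector)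
next
  assume rhs: ?rhs
  then have "z = stack (scens RC j i) (\<lambda>s. z $ s)"
    by (simp add: stack_def vec_eq_iff)
  with rhs show "z \<in> dual_set SP RC j i"
    unfolding dual_set_def by blast
qed

text \<open>There are finitely many linear constraints, one for each scenario and component. Each
  vanishing entry outside the subset is written as two opposite inequalities.\<close>

lemma polyhedron_dual_set: "polyhedron (dual_set SP RC j i)"
proof -
  let ?A = "scens RC j i"
  let ?g = "\<lambda>s k (z::real^_^_). (transpose (recourse SP) *v (z $ s)) $ k"
  have "linear (?g s k)" for s k
    by (intro linearI)
       (simp_all add: matrix_vector_right_distrib matrix_vector_mult_scaleR del: transpose_matrix_vector)
  then have 1: "polyhedron {z. ?g s k z \<le> c}" for s k c
    by (rule polyhedron_linear_le)
  have lin: "linear (\<lambda>z::real^_^_. z $ s $ k)" "linear (\<lambda>z::real^_^_. - (z $ s $ k))" for s k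
    by (intro linearI; simp)+
  have 2: "polyhedron ({z::real^_^_. z $ s $ k \<le> 0} \<inter> {z. - (z $ s $ k) \<le> 0})" for s k
    by (intro polyhedron_Int polyhedron_linear_le lin)
  have eq: "dual_set SP RC j i =
      \<Inter> ((\<lambda>(s, k). {z. ?g s k z \<le> pmf (law RC j i) s * scost SP s $ k}) ` (?A \<times> UNIV)) \<inter>
      \<Inter> ((\<lambda>(s, k). {z. z $ s $ k \<le> 0} \<inter> {z. - (z $ s $ k) \<le> 0}) ` ((- ?A) \<times> UNIV))"
    by (fastforce simp: mem_dual_set less_eq_vec_def vec_eq_iff simp del: transpose_matrix_vector
        intro: antisym)
  show ?thesis
    unfolding eq by (intro polyhedron_Int polyhedron_Inter; use 1 2 in \<open>auto simp del: polyhedron_Int\<close>)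
qed

lemma dual_coeff_inner:
  "dual_coeff SP RC j i x \<bullet> z =
     (\<Sum>s\<in>scens RC j i. (rhs SP s - tech SP s *v x) \<bullet> z $ s)"
proof -
  have "dual_coeff SP RC j i x \<bullet> z =
      (\<Sum>s\<in>UNIV. if s \<in> scens RC j i then (rhs SP s - tech SP s *v x) \<bullet> z $ s else 0)"
    unfolding dual_coeff_def stack_def inner_vec_def[of "_ - _" z] by (intro sum.cong) auto
  then show ?thesis by (simp add: sum.If_cases)
qed

text \<open>Multiplying the inequality of each scenario by its nonnegative probability yields the
  constraint of the corresponding block.\<close>

lemma scaled_stack_in_dual_set:
  assumes "\<And>s. l s \<in> scenario_dual_set SP s"
  shows "stack (scens RC j i) (\<lambda>s. pmf (law RC j i) s *\<^sub>R l s) \<in> dual_set SP RC j i"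
  using assms
  by (auto simp: mem_dual_set stack_def scenario_dual_set_def matrix_vector_mult_scaleR
      less_eq_vec_def mult_left_mono simp del: transpose_matrix_vector)

lemma dual_set_nonempty:
  assumes "\<And>s. scenario_dual_set SP s \<noteq> {}"
  shows "dual_set SP RC j i \<noteq> {}"
proof -
  have "\<forall>s. \<exists>l. l \<in> scenario_dual_set SP s" using assms by blast
  then obtain l where "\<And>s. l s \<in> scenario_dual_set SP s" by metis
  from scaled_stack_in_dual_set[OF this] show ?thesis by blast
qed

text \<open>Weak duality is applied to each block, whose cost vector is scaled by the law of the
  subset, and the bounds are added.\<close>

lemma dual_set_weak_duality:
  assumes "dep_feasible SP x y" "z \<in> dual_set SP RC j i"
  shows "dual_coeff SP RC j i x \<bullet> z \<le>
    (\<Sum>s\<in>scens RC j i. pmf (law RC j i) s * (scost SP s \<bullet> y s))"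
  unfolding dual_coeff_inner
proof (rule sum_mono)
  fix s assume "s \<in> scens RC j i"
  then have "transpose (recourse SP) *v (z $ s) \<le> pmf (law RC j i) s *\<^sub>R scost SP s"
    using assms(2) by (simp add: mem_dual_set)
  from lp_weak_duality[OF this, of "y s" "rhs SP s - tech SP s *v x"] assms(1)
  show "(rhs SP s - tech SP s *v x) \<bullet> z $ s \<le> pmf (law RC j i) s * (scost SP s \<bullet> y s)"
    by (simp add: dep_feasible_def)
qed

text \<open>The dual set is a product, so block \<open>s\<close> of the optimum can be exchanged for
  a scaled scenario dual point while all other blocks stay fixed and cancel in the
  comparison.\<close>

lemma dual_optimal_block:
  assumes opt: "dual_optimal SP RC j i x e" and s: "s \<in> scens RC j i"
    and l: "l \<in> scenario_dual_set SP s"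
  shows "pmf (law RC j i) s * ((rhs SP s - tech SP s *v x) \<bullet> l) \<le>
    (rhs SP s - tech SP s *v x) \<bullet> e $ s"
proof -
  define z where "z = (\<chi> s'. if s' = s then pmf (law RC j i) s *\<^sub>R l else e $ s')"
  let ?b = "\<lambda>s. rhs SP s - tech SP s *v x"
  have "z \<in> dual_set SP RC j i"
    using opt s l
    by (auto simp: dual_optimal_def mem_dual_set z_def scenario_dual_set_def
        matrix_vector_mult_scaleR less_eq_vec_def mult_left_mono simp del: transpose_matrix_vector)
  then have "(\<Sum>s'\<in>scens RC j i. ?b s' \<bullet> z $ s') \<le> (\<Sum>s'\<in>scens RC j i. ?b s' \<bullet> e $ s')"
    using opt by (simp add: dual_optimal_def dual_coeff_inner)
  moreover have "(\<Sum>s'\<in>scens RC j i - {s}. ?b s' \<bullet> z $ s') = (\<Sum>s'\<in>scens RC j i - {s}. ?b s' \<bullet> e $ s')"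
    by (intro sum.cong) (auto simp: z_def)
  ultimately have "?b s \<bullet> z $ s \<le> ?b s \<bullet> e $ s"
    using s by (simp add: sum.remove[of "scens RC j i" s])
  then show ?thesis by (simp add: z_def)
qed

text \<open>Dividing the block value by the positive probability bounds the dual problem of the
  single scenario, and strong duality turns this bound into a recourse vector.\<close>

lemma dual_optimal_recourse:
  assumes opt: "dual_optimal SP RC j i x e" and s: "s \<in> scens RC j i"
    and pos: "0 < pmf (law RC j i) s" and ne: "scenario_dual_set SP s \<noteq> {}"
  obtains y where "0 \<le> y" "recourse SP *v y = rhs SP s - tech SP s *v x"
    "pmf (law RC j i) s * (scost SP s \<bullet> y) \<le> (rhs SP s - tech SP s *v x) \<bullet> e $ s"
proof -
  let ?b = "rhs SP s - tech SP s *v x" and ?p = "pmf (law RC j i) s"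
  obtain l0 where l0: "transpose (recourse SP) *v l0 \<le> scost SP s"
    using ne by (auto simp: scenario_dual_set_def simp del: transpose_matrix_vector)
  have "?b \<bullet> l \<le> (?b \<bullet> e $ s) / ?p" if "transpose (recourse SP) *v l \<le> scost SP s" for l
    using dual_optimal_block[OF opt s, of l] that pos
    by (simp add: scenario_dual_set_def pos_le_divide_eq mult.commute del: transpose_matrix_vector)
  from lp_strong_duality[OF l0 this] obtain y where
    "0 \<le> y" "recourse SP *v y = ?b" "scost SP s \<bullet> y \<le> (?b \<bullet> e $ s) / ?p" by blast
  with pos show thesis
    by (intro that[of y]) (auto simp: pos_le_divide_eq mult.commute)
qed

text \<open>A recession direction only forces unboundedness from some feasible point, which the
  nonempty scenario dual sets provide.\<close>

lemma dual_unbounded_if_ray: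
  assumes "r \<in> recession_cone (dual_set SP RC j i)" "dual_coeff SP RC j i x \<bullet> r > 0"
    "\<And>s. scenario_dual_set SP s \<noteq> {}"
  shows "dual_unbounded SP RC j i x"
proof (rule ccontr)
  assume "\<not> dual_unbounded SP RC j i x"
  then obtain v where v: "\<And>z. z \<in> dual_set SP RC j i \<Longrightarrow> dual_coeff SP RC j i x \<bullet> z \<le> v"
    by (auto simp: dual_unbounded_def bdd_above_def)
  from dual_set_nonempty[OF assms(3)] obtain z where "z \<in> dual_set SP RC j i" by blast
  from inner_recession_cone_nonpos[OF assms(1) this v] assms(2) show False by simp
qed

text \<open>Positive scaling keeps the sign of the objective, so an improving extreme ray can be
  traded for its representative in \<open>R\<close>.\<close>

lemma ray_representative_positive:
  assumes "ray_representatives C R" "r extreme_ray_of C" "a \<bullet> r > 0"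
  obtains r' where "r' \<in> R" "a \<bullet> r' > 0"
proof -
  obtain r' t where "r' \<in> R" "0 < t" "r = t *\<^sub>R r'"
    using assms(1,2) unfolding ray_representatives_def by blast
  with assms(3) show thesis by (intro that[of r']) (auto simp: zero_less_mult_iff)
qed

section \<open>The L-shaped procedure\<close>

text \<open>This makes \<open>initial_cuts\<close> an invariant: each new cut comes from
  \<open>R\<close> or from the extreme points, and at most one per subset is added.\<close>

lemma initial_cuts_step:
  assumes "initial_cuts SP RC j R C" "lshaped_step SP RC j R C C'"
  shows "initial_cuts SP RC j R C'"
  unfolding initial_cuts_def
proof
  fix i assume i: "i \<in> {1..nsub RC j}"
  from assms(2) obtain x \<theta> where "add_cuts SP RC j R x \<theta> C C'"
    unfolding lshaped_step_def by blast
  with i have "(\<exists>r\<in>R i. fst C' i = insert r (fst C i) \<and> snd C' i = snd C i) \<or>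
      (\<exists>e\<in>dual_extreme_points SP RC j i.
         fst C' i = fst C i \<and> (snd C' i = insert e (snd C i) \<or> snd C' i = snd C i))"
    unfolding add_cuts_def by (metis (no_types, lifting))
  moreover have "finite (fst C i)" "fst C i \<subseteq> R i" "finite (snd C i)"
    "snd C i \<subseteq> dual_extreme_points SP RC j i"
    using assms(1) i by (auto simp: initial_cuts_def all_cuts_def)
  ultimately show "finite (fst C' i) \<and> fst C' i \<subseteq> fst (all_cuts SP RC j R) i \<and>
      finite (snd C' i) \<and> snd C' i \<subseteq> snd (all_cuts SP RC j R) i"
    unfolding all_cuts_def by auto
qed

text \<open>The progress measure for termination.\<close>

definition num_cuts :: "('s::finite) subset_chain \<Rightarrow> nat \<Rightarrow> ('p::finite, 's) cuts \<Rightarrow> nat" where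
  "num_cuts RC j C = (\<Sum>i=1..nsub RC j. card (fst C i) + card (snd C i))"

text \<open>Comparing cardinalities requires the full cut sets to be finite; this holds because the
  dual sets are polyhedra.\<close>

lemma num_cuts_le:
  assumes "initial_cuts SP RC j R C"
    and "\<And>i. i \<in> {1..nsub RC j} \<Longrightarrow> ray_representatives (dual_set SP RC j i) (R i)"
  shows "num_cuts RC j C \<le> num_cuts RC j (all_cuts SP RC j R)"
  unfolding num_cuts_def
proof (intro sum_mono add_mono card_mono)
  fix i assume i: "i \<in> {1..nsub RC j}"
  show "finite (fst (all_cuts SP RC j R) i)"
    using finite_ray_representatives[OF polyhedron_dual_set assms(2)[OF i]]
    by (simp add: all_cuts_def)
  show "finite (snd (all_cuts SP RC j R) i)"
    using finite_polyhedron_extreme_points[OF polyhedron_dual_set]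
    by (simp add: all_cuts_def dual_extreme_points_def)
qed (use assms(1) in \<open>auto simp: initial_cuts_def\<close>)

text \<open>The trial solution satisfies every cut already kept, so a violated cut that is added is
  new. No count decreases, and the count of a subset with a violated cut grows.\<close>

lemma num_cuts_step:
  assumes init: "initial_cuts SP RC j R C" and step: "lshaped_step SP RC j R C C'"
    and ne: "\<And>s. scenario_dual_set SP s \<noteq> {}"
    and rays: "\<And>i. i \<in> {1..nsub RC j} \<Longrightarrow> ray_representatives (dual_set SP RC j i) (R i)"
  shows "num_cuts RC j C < num_cuts RC j C'"
proof -
  from step obtain x \<theta> where feas: "master_feasible SP RC j C x \<theta>"
    and viol: "violated_cut_exists SP RC j R x \<theta>" and add: "add_cuts SP RC j R x \<theta> C C'"
    unfolding lshaped_step_def master_optimal_def by blast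
  let ?c = "\<lambda>i. dual_coeff SP RC j i x"
  let ?n = "\<lambda>C i. card (fst C i) + card (snd C i)"
  have fin: "finite (fst C i)" "finite (snd C i)" if "i \<in> {1..nsub RC j}" for i
    using init that by (auto simp: initial_cuts_def)
  have unb: "?n C i < ?n C' i" if i: "i \<in> {1..nsub RC j}" and "dual_unbounded SP RC j i x" for i
  proof -
    from add that obtain r where "?c i \<bullet> r > 0" "fst C' i = insert r (fst C i)" "snd C' i = snd C i"
      unfolding add_cuts_def by (metis (no_types, lifting))
    moreover from this feas i have "r \<notin> fst C i" by (force simp: master_feasible_def)
    ultimately show ?thesis using fin[OF i] by simp
  qed
  have bdd: "\<exists>e. dual_optimal SP RC j i x e \<and> fst C' i = fst C i \<and>
      snd C' i = (if ?c i \<bullet> e > \<theta> i then insert e (snd C i) else snd C i) \<and>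
      (?c i \<bullet> e > \<theta> i \<longrightarrow> e \<notin> snd C i)"
    if i: "i \<in> {1..nsub RC j}" and "\<not> dual_unbounded SP RC j i x" for i
  proof -
    from add that obtain e where e: "dual_optimal SP RC j i x e" "fst C' i = fst C i"
      "snd C' i = (if ?c i \<bullet> e > \<theta> i then insert e (snd C i) else snd C i)"
      unfolding add_cuts_def by (metis (no_types, lifting))
    moreover have "e \<notin> snd C i" if "?c i \<bullet> e > \<theta> i"
      using feas i that by (force simp: master_feasible_def)
    ultimately show ?thesis by blast
  qed
  have mono: "?n C i \<le> ?n C' i" if i: "i \<in> {1..nsub RC j}" for i
  proof (cases "dual_unbounded SP RC j i x")
    case True
    then show ?thesis using unb[OF i] by simp
  next
    case False
    then show ?thesis using bdd[OF i] fin[OF i] by (auto simp: card_insert_le)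
  qed
  from viol obtain i where i: "i \<in> {1..nsub RC j}"
    and cut: "(\<exists>r\<in>R i. ?c i \<bullet> r > 0) \<or> (\<exists>e\<in>dual_extreme_points SP RC j i. ?c i \<bullet> e > \<theta> i)"
    unfolding violated_cut_exists_def all_cuts_def fst_conv snd_conv by blast
  have "?n C i < ?n C' i"
  proof (cases "dual_unbounded SP RC j i x")
    case True
    then show ?thesis by (rule unb[OF i])
  next
    case False
    \<comment> \<open>A bounded subproblem violates no feasibility cut, so the violated cut comes
      from some extreme point \<open>e\<close>.\<close>
    have "\<not> ?c i \<bullet> r > 0" if "r \<in> R i" for r
      using False dual_unbounded_if_ray[OF extreme_ray_in_recession_cone _ ne] rays[OF i] that
      by (metis ray_representatives_def)
    with cut obtain e where e: "e \<in> dual_extreme_points SP RC j i" "?c i \<bullet> e > \<theta> i" by blast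
    from bdd[OF i False] obtain e' where e': "dual_optimal SP RC j i x e'" "fst C' i = fst C i"
      "snd C' i = (if ?c i \<bullet> e' > \<theta> i then insert e' (snd C i) else snd C i)"
      "?c i \<bullet> e' > \<theta> i \<longrightarrow> e' \<notin> snd C i" by blast
    have "e \<in> dual_set SP RC j i"
      using e(1) by (auto simp: dual_extreme_points_def extreme_point_of_def)
    \<comment> \<open>The optimal \<open>e'\<close> has at least the value of \<open>e\<close>, so
      the cut selected by the procedure is violated too.\<close>
    with e' e(2) have "?c i \<bullet> e' > \<theta> i" unfolding dual_optimal_def by force
    with e' fin[OF i] show ?thesis by simp
  qed
  with i mono show ?thesis
    unfolding num_cuts_def by (intro sum_strict_mono_ex1) auto
qed

lemma initial_cuts_reachable:
  assumes "(lshaped_step SP RC j R)\<^sup>*\<^sup>* C0 C" "initial_cuts SP RC j R C0"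
  shows "initial_cuts SP RC j R C"
  using assms by (induction rule: rtranclp_induct) (blast dest: initial_cuts_step)+

text \<open>An infinite run would make the number of cuts a strictly increasing sequence of naturals
  below a fixed bound.\<close>

lemma lshaped_terminates:
  assumes init: "initial_cuts SP RC j R C0"
    and ne: "\<And>s. scenario_dual_set SP s \<noteq> {}"
    and rays: "\<And>i. i \<in> {1..nsub RC j} \<Longrightarrow> ray_representatives (dual_set SP RC j i) (R i)"
  shows "\<not> (\<exists>C. C 0 = C0 \<and> (\<forall>k. lshaped_step SP RC j R (C k) (C (Suc k))))"
proof
  assume "\<exists>C. C 0 = C0 \<and> (\<forall>k. lshaped_step SP RC j R (C k) (C (Suc k)))"
  then obtain C where C: "C 0 = C0" "\<And>k. lshaped_step SP RC j R (C k) (C (Suc k))" by blast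
  have inv: "initial_cuts SP RC j R (C k)" for k
  proof (induction k)
    case 0
    show ?case using init C(1) by simp
  next
    case (Suc k)
    then show ?case using C(2) by (rule initial_cuts_step)
  qed
  have "strict_mono (\<lambda>k. num_cuts RC j (C k))"
    unfolding strict_mono_Suc_iff by (intro allI num_cuts_step[OF inv C(2)] ne rays)
  \<comment> \<open>A strictly increasing sequence of naturals dominates its index, so the index one
    past the bound gives a contradiction.\<close>
  then have "Suc (num_cuts RC j (all_cuts SP RC j R)) \<le>
      num_cuts RC j (C (Suc (num_cuts RC j (all_cuts SP RC j R))))"
    by (rule strict_mono_imp_increasing)
  also have "\<dots> \<le> num_cuts RC j (all_cuts SP RC j R)"
    by (intro num_cuts_le[OF inv] rays)
  finally show False by simp
qed

text \<open>The dichotomy matches the case split of the procedure: an attained optimum excludes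
  unboundedness, and an improving extreme ray forces it.\<close>

lemma add_cuts_exists:
  assumes dich: "\<And>i. i \<in> {1..nsub RC j} \<Longrightarrow> dual_dichotomy SP RC j i x"
    and ne: "\<And>s. scenario_dual_set SP s \<noteq> {}"
    and rays: "\<And>i. i \<in> {1..nsub RC j} \<Longrightarrow> ray_representatives (dual_set SP RC j i) (R i)"
  shows "\<exists>C'. add_cuts SP RC j R x \<theta> C C'"
proof -
  let ?c = "\<lambda>i. dual_coeff SP RC j i x"
  have "\<exists>D. if dual_unbounded SP RC j i x
        then \<exists>r\<in>R i. ?c i \<bullet> r > 0 \<and> fst D = insert r (fst C i) \<and> snd D = snd C i
        else \<exists>e\<in>dual_extreme_points SP RC j i. dual_optimal SP RC j i x e \<and> fst D = fst C i \<and>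
               snd D = (if ?c i \<bullet> e > \<theta> i then insert e (snd C i) else snd C i)"
    if i: "i \<in> {1..nsub RC j}" for i
  proof (cases "dual_unbounded SP RC j i x")
    case True
    then have "\<not> dual_optimal SP RC j i x e" for e
      by (auto simp: dual_unbounded_def dual_optimal_def bdd_above_def)
    then obtain r where "r extreme_ray_of dual_set SP RC j i" "?c i \<bullet> r > 0"
      using dich[OF i] unfolding dual_dichotomy_def by blast
    with rays[OF i] obtain r' where "r' \<in> R i" "?c i \<bullet> r' > 0"
      by (rule ray_representative_positive)
    with True show ?thesis by (intro exI[of _ "(insert r' (fst C i), snd C i)"]) auto
  next
    case False
    then obtain e where "e \<in> dual_extreme_points SP RC j i" "dual_optimal SP RC j i x e"
      using dich[OF i] dual_unbounded_if_ray[OF extreme_ray_in_recession_cone _ ne]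
      unfolding dual_dichotomy_def by blast
    with False show ?thesis
      by (intro exI[of _ "(fst C i, if ?c i \<bullet> e > \<theta> i then insert e (snd C i) else snd C i)"]) auto
  qed
  then obtain D where "\<And>i. i \<in> {1..nsub RC j} \<Longrightarrow> if dual_unbounded SP RC j i x
        then \<exists>r\<in>R i. ?c i \<bullet> r > 0 \<and> fst (D i) = insert r (fst C i) \<and> snd (D i) = snd C i
        else \<exists>e\<in>dual_extreme_points SP RC j i. dual_optimal SP RC j i x e \<and> fst (D i) = fst C i \<and>
               snd (D i) = (if ?c i \<bullet> e > \<theta> i then insert e (snd C i) else snd C i)"
    by metis
  then have "add_cuts SP RC j R x \<theta> C (\<lambda>i. fst (D i), \<lambda>i. snd (D i))"
    unfolding add_cuts_def by simp
  then show ?thesis by blast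
qed

section \<open>The master problem and the deterministic equivalent\<close>

lemma refinement_chain_level:
  assumes "refinement_chain P RC" "j \<in> {1..levels RC}"
  shows "(\<Union>i\<in>{1..nsub RC j}. scens RC j i) = UNIV"
    and "\<forall>i\<in>{1..nsub RC j}. set_pmf (law RC j i) = scens RC j i"
    and "\<forall>i\<in>{1..nsub RC j}. weight RC j i \<ge> 0"
    and "\<forall>s. pmf P s = (\<Sum>i=1..nsub RC j. weight RC j i * pmf (law RC j i) s)"
  using bspec[OF assms(1)[unfolded refinement_chain_def, THEN conjunct2, THEN conjunct2,
      THEN conjunct2, THEN conjunct2, THEN conjunct1] assms(2)]
  by blast+

text \<open>Each law vanishes off its subset, so the inner sums extend to all scenarios. After
  exchanging the sums, the mixture identity of the level collapses the weights.\<close>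

lemma sum_weighted_scenario_values:
  assumes "refinement_chain P RC" "j \<in> {1..levels RC}"
  shows "(\<Sum>i=1..nsub RC j. weight RC j i * (\<Sum>s\<in>scens RC j i. pmf (law RC j i) s * g s)) =
    (\<Sum>s\<in>UNIV. pmf P s * g s)"
proof -
  have supp: "\<And>i. i \<in> {1..nsub RC j} \<Longrightarrow> set_pmf (law RC j i) = scens RC j i"
    and mix: "\<And>s. pmf P s = (\<Sum>i=1..nsub RC j. weight RC j i * pmf (law RC j i) s)"
    using refinement_chain_level[OF assms] by simp_all
  have "(\<Sum>s\<in>scens RC j i. pmf (law RC j i) s * g s) = (\<Sum>s\<in>UNIV. pmf (law RC j i) s * g s)"
    if "i \<in> {1..nsub RC j}" for i
    using supp[OF that] by (intro sum.mono_neutral_left) (auto simp: set_pmf_eq)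
  then have "(\<Sum>i=1..nsub RC j. weight RC j i * (\<Sum>s\<in>scens RC j i. pmf (law RC j i) s * g s)) =
      (\<Sum>i=1..nsub RC j. \<Sum>s\<in>UNIV. weight RC j i * pmf (law RC j i) s * g s)"
    by (intro sum.cong) (auto simp: sum_distrib_left mult.assoc)
  also have "\<dots> = (\<Sum>s\<in>UNIV. \<Sum>i=1..nsub RC j. weight RC j i * pmf (law RC j i) s * g s)"
    by (rule sum.swap)
  also have "\<dots> = (\<Sum>s\<in>UNIV. pmf P s * g s)"
    by (simp add: mix sum_distrib_right)
  finally show ?thesis .
qed

text \<open>The master problem is a relaxation of (DEP): with \<theta> taken as the expected
  recourse cost under the law of each subset, weak duality yields all cuts and the objectives
  agree.\<close>

lemma dep_feasible_master:
  assumes chain: "refinement_chain (prob SP) RC" and level: "j \<in> {1..levels RC}"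
    and ne: "\<And>s. scenario_dual_set SP s \<noteq> {}"
    and rays: "\<And>i. i \<in> {1..nsub RC j} \<Longrightarrow> ray_representatives (dual_set SP RC j i) (R i)"
    and feas: "dep_feasible SP x y"
  obtains \<theta> where "master_feasible SP RC j (all_cuts SP RC j R) x \<theta>"
    "master_objective SP RC j x \<theta> = dep_objective SP x y"
proof -
  define \<theta> where "\<theta> i = (\<Sum>s\<in>scens RC j i. pmf (law RC j i) s * (scost SP s \<bullet> y s))" for i
  have le: "dual_coeff SP RC j i x \<bullet> z \<le> \<theta> i" if "z \<in> dual_set SP RC j i" for i z
    unfolding \<theta>_def using feas that by (rule dual_set_weak_duality)
  have "dual_coeff SP RC j i x \<bullet> r \<le> 0" if "i \<in> {1..nsub RC j}" "r \<in> R i" for i r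
  proof -
    obtain z where z: "z \<in> dual_set SP RC j i" using dual_set_nonempty[OF ne] by blast
    have "r \<in> recession_cone (dual_set SP RC j i)"
      using rays that by (simp add: ray_representatives_def extreme_ray_in_recession_cone)
    then show ?thesis using z le by (rule inner_recession_cone_nonpos)
  qed
  then have "master_feasible SP RC j (all_cuts SP RC j R) x \<theta>"
    using feas le
    by (auto simp: master_feasible_def all_cuts_def dual_extreme_points_def dep_feasible_def
        extreme_point_of_def)
  moreover have "master_objective SP RC j x \<theta> = dep_objective SP x y"
    using sum_weighted_scenario_values[OF chain level, of "\<lambda>s. scost SP s \<bullet> y s"]
    by (simp add: master_objective_def dep_objective_def \<theta>_def)
  ultimately show thesis by (rule that)
qed

text \<open>The converse of the relaxation: the feasibility cuts rule out the ray alternative, so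
  each subproblem attains an optimum, which the optimality cuts keep below \<theta>. Strong duality
  for each scenario then supplies the recourse vectors.\<close>

lemma master_feasible_dep:
  assumes chain: "refinement_chain (prob SP) RC" and level: "j \<in> {1..levels RC}"
    and ne: "\<And>s. scenario_dual_set SP s \<noteq> {}"
    and rays: "\<And>i. i \<in> {1..nsub RC j} \<Longrightarrow> ray_representatives (dual_set SP RC j i) (R i)"
    and dich: "\<And>i. i \<in> {1..nsub RC j} \<Longrightarrow> dual_dichotomy SP RC j i x"
    and feas: "master_feasible SP RC j (all_cuts SP RC j R) x \<theta>"
  obtains y where "dep_feasible SP x y" "dep_objective SP x y \<le> master_objective SP RC j x \<theta>"
proof -
  let ?I = "{1..nsub RC j}" and ?c = "\<lambda>i. dual_coeff SP RC j i x"
  let ?b = "\<lambda>s. rhs SP s - tech SP s *v x"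
  have cover: "(\<Union>i\<in>?I. scens RC j i) = UNIV"
    and supp: "\<And>i. i \<in> ?I \<Longrightarrow> set_pmf (law RC j i) = scens RC j i"
    and weight: "\<And>i. i \<in> ?I \<Longrightarrow> weight RC j i \<ge> 0"
    using refinement_chain_level[OF chain level] by simp_all
  have xX: "x \<in> xset SP" using feas by (simp add: master_feasible_def)
  have "\<exists>e. dual_optimal SP RC j i x e \<and> ?c i \<bullet> e \<le> \<theta> i" if i: "i \<in> ?I" for i
  proof -
    have "\<not> ?c i \<bullet> r > 0" if "r extreme_ray_of dual_set SP RC j i" for r
    proof
      assume "?c i \<bullet> r > 0"
      with rays[OF i] that obtain r' where "r' \<in> R i" "?c i \<bullet> r' > 0"
        by (rule ray_representative_positive)
      with feas i show False by (force simp: master_feasible_def all_cuts_def)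
    qed
    then show ?thesis
      using dich[OF i] feas i by (auto simp: dual_dichotomy_def master_feasible_def all_cuts_def)
  qed
  then obtain e where e: "\<And>i. i \<in> ?I \<Longrightarrow> dual_optimal SP RC j i x (e i)"
    "\<And>i. i \<in> ?I \<Longrightarrow> ?c i \<bullet> e i \<le> \<theta> i" by metis
  have pos: "0 < pmf (law RC j i) s" if "i \<in> ?I" "s \<in> scens RC j i" for i s
    using supp that by (metis pmf_positive)
  \<comment> \<open>A scenario may lie in several subsets; a cheapest recourse vector serves all of them.\<close>
  have "\<exists>y. 0 \<le> y \<and> recourse SP *v y = ?b s \<and>
      (\<forall>i\<in>?I. s \<in> scens RC j i \<longrightarrow> pmf (law RC j i) s * (scost SP s \<bullet> y) \<le> ?b s \<bullet> e i $ s)" for s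
  proof -
    let ?ok = "\<lambda>i y. 0 \<le> y \<and> recourse SP *v y = ?b s \<and>
      pmf (law RC j i) s * (scost SP s \<bullet> y) \<le> ?b s \<bullet> e i $ s"
    have "\<exists>y. ?ok i y" if "i \<in> ?I" "s \<in> scens RC j i" for i
      using dual_optimal_recourse[OF e(1) that(2) pos ne] that by metis
    then obtain Y where Y: "\<And>i. i \<in> ?I \<Longrightarrow> s \<in> scens RC j i \<Longrightarrow> ?ok i (Y i)" by metis
    let ?M = "{i\<in>?I. s \<in> scens RC j i}"
    \<comment> \<open>The subsets of a level cover all scenarios, so there is a candidate vector
      over which the cost can be minimized.\<close>
    have "?M \<noteq> {}" using cover by blast
    then obtain m where m: "m \<in> ?M" "\<And>i. i \<in> ?M \<Longrightarrow> scost SP s \<bullet> Y m \<le> scost SP s \<bullet> Y i"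
      using arg_min_if_finite(1)[of ?M "\<lambda>i. scost SP s \<bullet> Y i"]
        arg_min_least[of ?M _ "\<lambda>i. scost SP s \<bullet> Y i"] by fastforce
    \<comment> \<open>The minimal cost is at most the cost of the candidate for \<open>i\<close>,
      and multiplying by a probability preserves this.\<close>
    have "pmf (law RC j i) s * (scost SP s \<bullet> Y m) \<le> ?b s \<bullet> e i $ s" if "i \<in> ?M" for i
      using mult_left_mono[OF m(2)[OF that], of "pmf (law RC j i) s"] Y[of i] that by auto
    then show ?thesis using Y[of m] m(1) by blast
  qed
  then obtain y where y: "\<And>s. 0 \<le> y s" "\<And>s. recourse SP *v y s = ?b s"
    "\<And>s i. i \<in> ?I \<Longrightarrow> s \<in> scens RC j i \<Longrightarrow>
       pmf (law RC j i) s * (scost SP s \<bullet> y s) \<le> ?b s \<bullet> e i $ s"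
    by metis
  have "dep_feasible SP x y" using xX y by (simp add: dep_feasible_def)
  moreover have "dep_objective SP x y \<le> master_objective SP RC j x \<theta>"
  proof -
    have "(\<Sum>s\<in>scens RC j i. pmf (law RC j i) s * (scost SP s \<bullet> y s)) \<le> \<theta> i" if "i \<in> ?I" for i
    proof -
      have "(\<Sum>s\<in>scens RC j i. pmf (law RC j i) s * (scost SP s \<bullet> y s)) \<le> ?c i \<bullet> e i"
        unfolding dual_coeff_inner using y(3) that by (intro sum_mono) auto
      then show ?thesis using e(2)[OF that] by linarith
    qed
    then show ?thesis
      unfolding dep_objective_def master_objective_def
        sum_weighted_scenario_values[OF chain level, symmetric]
      by (intro add_left_mono sum_mono mult_left_mono weight) auto
  qed
  ultimately show thesis by (rule that)
qed

theorem theorem3p10: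
  fixes SP :: "('n::finite, 'm::finite, 'p::finite, 's::finite) two_stage"
    and RC :: "'s subset_chain"
    and R :: "nat \<Rightarrow> (real^'p^'s) set"
    and C0 :: "('p, 's) cuts"
    and j :: nat
  assumes program: "two_stage_program SP"
    and dep_solvable: "\<exists>x y. dep_optimal SP x y"
    and chain: "refinement_chain (prob SP) RC"
    and chain_type: "disjoint_type (prob SP) RC \<or> (\<exists>F. fixed_type (prob SP) F RC)"
    and dual_nonempty: "\<And>s. scenario_dual_set SP s \<noteq> {}"
    and dichotomy: "\<And>k i x. k \<in> {1..levels RC} \<Longrightarrow> i \<in> {1..nsub RC k} \<Longrightarrow> x \<in> xset SP
                      \<Longrightarrow> dual_dichotomy SP RC k i x"
    and level: "j \<in> {1..levels RC}"
    and rays: "\<And>i. i \<in> {1..nsub RC j} \<Longrightarrow> ray_representatives (dual_set SP RC j i) (R i)"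
    and initial: "initial_cuts SP RC j R C0"
    and relaxed_solvable: "\<And>C. (lshaped_step SP RC j R)\<^sup>*\<^sup>* C0 C \<Longrightarrow> \<exists>x \<theta>. master_optimal SP RC j C x \<theta>"
  shows
    \<comment> \<open>every iteration can be carried out\<close>
    "(\<forall>C x \<theta>. (lshaped_step SP RC j R)\<^sup>*\<^sup>* C0 C \<and> master_optimal SP RC j C x \<theta> \<longrightarrow>
        (\<exists>C'. add_cuts SP RC j R x \<theta> C C')) \<and>
     \<comment> \<open>the procedure stops after finitely many iterations\<close>
     \<not> (\<exists>C. C 0 = C0 \<and> (\<forall>k. lshaped_step SP RC j R (C k) (C (Suc k)))) \<and>
     \<comment> \<open>when it stops, it has solved the master problem of level j and (DEP), with equal values\<close>
     (\<forall>C x \<theta>. (lshaped_step SP RC j R)\<^sup>*\<^sup>* C0 C \<and> master_optimal SP RC j C x \<theta> \<and>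
        \<not> violated_cut_exists SP RC j R x \<theta> \<longrightarrow>
        master_optimal SP RC j (all_cuts SP RC j R) x \<theta> \<and>
        (\<exists>y. dep_optimal SP x y \<and> master_objective SP RC j x \<theta> = dep_objective SP x y))"
proof (intro conjI allI impI; (elim conjE)?)
  fix C x \<theta>
  assume "master_optimal SP RC j C x \<theta>"
  then have "x \<in> xset SP" by (simp add: master_optimal_def master_feasible_def)
  then show "\<exists>C'. add_cuts SP RC j R x \<theta> C C'"
    using dichotomy[OF level] dual_nonempty rays by (intro add_cuts_exists)
next
  show "\<not> (\<exists>C. C 0 = C0 \<and> (\<forall>k. lshaped_step SP RC j R (C k) (C (Suc k))))"
    using initial dual_nonempty rays by (rule lshaped_terminates)
next
  fix C x \<theta>
  assume reach: "(lshaped_step SP RC j R)\<^sup>*\<^sup>* C0 C" and opt: "master_optimal SP RC j C x \<theta>"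
    and stop: "\<not> violated_cut_exists SP RC j R x \<theta>"
  let ?all = "all_cuts SP RC j R"
  have x: "x \<in> xset SP" using opt by (simp add: master_optimal_def master_feasible_def)
  \<comment> \<open>At termination the trial solution violates no cut at all, so it is feasible for
    the full master problem.\<close>
  have feas: "master_feasible SP RC j ?all x \<theta>"
    using x stop by (auto simp: master_feasible_def violated_cut_exists_def not_less)
  \<comment> \<open>Reachable cuts form a subset of all cuts, so the current master relaxes the full
    one; optimality of a point feasible for both carries over.\<close>
  have sub: "master_feasible SP RC j C x' \<theta>'" if "master_feasible SP RC j ?all x' \<theta>'" for x' \<theta>'
    using that initial_cuts_reachable[OF reach initial]
    unfolding master_feasible_def initial_cuts_def by blast
  show all_opt: "master_optimal SP RC j ?all x \<theta>"
    using feas sub opt by (simp add: master_optimal_def)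
  obtain y where y: "dep_feasible SP x y" "dep_objective SP x y \<le> master_objective SP RC j x \<theta>"
    using master_feasible_dep[OF chain level dual_nonempty rays dichotomy[OF level _ x] feas] by blast
  \<comment> \<open>The master value bounds every (DEP) value from below, while the recourse vectors
    \<open>y\<close> attain at most this value; the two bounds give optimality and equal
    values.\<close>
  have lower: "master_objective SP RC j x \<theta> \<le> dep_objective SP x' y'"
    if "dep_feasible SP x' y'" for x' y'
    using dep_feasible_master[OF chain level dual_nonempty rays that] all_opt
    unfolding master_optimal_def by metis
  have "dep_optimal SP x y"
    unfolding dep_optimal_def using y lower order_trans by blast
  moreover have "master_objective SP RC j x \<theta> = dep_objective SP x y"
    using y(2) lower[OF y(1)] by (rule antisym[rotated])
  ultimately show "\<exists>y. dep_optimal SP x y \<and> master_objective SP RC j x \<theta> = dep_objective SP x y"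
    by blast
qed

end
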